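(* There is an absolute constant $C>0$ such that the following holds. Let $f:\mathbb{R}^d\to\mathbb{R}$ be glocally $(L,L_*,\delta)$-smooth, locally $\mu_*$-strongly convex with $\mu_*>0$ (on the region $f(w)-f_*\le\delta$), globally convex, and coercive, and let $f_*$ be the infimum of $f$. Let $w_0\in\mathbb{R}^d$ and let $\epsilon$ satisfy $f(w_0)-f_*>\delta>\epsilon>0$. For all $t\ge0$ let $$w_{t+1}=w_t-\eta_t\nabla f(w_t),\qquad \eta_t\in\arg\min_\eta f(w_t-\eta\nabla f(w_t)).$$ Then $f(w_T)-f_*\le\epsilon$ for all integers $T$ with $$T\ge C\left(\frac{L}{\delta}R^2(f(w_0))+\frac{L_*}{\mu_*}\log\left(\frac{\delta}{\epsilon}\right)\right).$$
   Context: $\|\cdot\|$ is the Euclidean norm, functions are differentiable, and $L,L_*,\delta>0$. Coercive means $f(w)\to\infty$ as $\|w\|\to\infty$. Glocal smoothness: $f$ with infimum $f_*$ is glocally $(L,L_*,\delta)$-smooth if (i) $\|\nabla f(u)-\nabla f(v)\|\le L\|u-v\|$ for all $u,v\in\mathbb{R}^d$, and (ii) $\|\nabla f(u)-\nabla f(v)\|\le L_*\|u-v\|$ for all $u,v$ in the set $\{u: f(u)-f_*\le\delta\}$. Local strong convexity: $f(v)\ge f(u)+\langle\nabla f(u),v-u\rangle+\frac{\mu_*}{2}\|v-u\|^2$ for all $u,v$ in $\{u:f(u)-f_*\le\delta\}$ (same $\delta$). For $\rho\in\mathbb{R}$, $R^2(\rho)=\max_{w\in\mathbb{R}^d,\,w_*\in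 W_*}\{\|w-w_*\|^2: f(w)\le\rho\}$, where $W_*$ is the set of minimizers of $f$. *)

theory Defs
  imports "HOL-Analysis.Analysis"
begin

text \<open>
  The constant in the theorem must not depend on the dimension \<open>d\<close>, so \<open>d\<close> has to be bound inside
  the formula and cannot be a type. Hence every Euclidean space is realised as the coordinate
  subspace \<open>Rn d\<close> of one real inner product space, the finitely supported real sequences with
  the standard (Euclidean) inner product. Norm, inner product, topology, derivatives and convexity
  are then those of the library, restricted to the carrier \<open>Rn d\<close>.
\<close>

typedef fseq = "{x :: nat \<Rightarrow> real. finite {i. x i \<noteq> 0}}"
  morphisms coord Abs_fseq
  by (rule exI[of _ "\<lambda>_. 0"]) simp

setup_lifting type_definition_fseq

lemma finite_coord: "finite {i. coord x i \<noteq> 0}"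
  using coord[of x] by simp

lemma fseq_eqI: "(\<And>i. coord x i = coord y i) \<Longrightarrow> x = y"
  by (metis coord_inject ext)

instantiation fseq :: real_vector
begin

lift_definition zero_fseq :: fseq is "\<lambda>_. 0" by simp

lift_definition plus_fseq :: "fseq \<Rightarrow> fseq \<Rightarrow> fseq" is "\<lambda>x y i. x i + y i"
  subgoal for x y by (rule finite_subset[of _ "{i. x i \<noteq> 0} \<union> {i. y i \<noteq> 0}"]) auto
  done

lift_definition minus_fseq :: "fseq \<Rightarrow> fseq \<Rightarrow> fseq" is "\<lambda>x y i. x i - y i"
  subgoal for x y by (rule finite_subset[of _ "{i. x i \<noteq> 0} \<union> {i. y i \<noteq> 0}"]) auto
  done

lift_definition uminus_fseq :: "fseq \<Rightarrow> fseq" is "\<lambda>x i. - x i" by simp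

lift_definition scaleR_fseq :: "real \<Rightarrow> fseq \<Rightarrow> fseq" is "\<lambda>c x i. c * x i"
  by (erule finite_subset[rotated]) auto

instance
  by standard (transfer, simp add: algebra_simps fun_eq_iff)+

end

lemmas coord_simps [simp] =
  zero_fseq.rep_eq plus_fseq.rep_eq minus_fseq.rep_eq uminus_fseq.rep_eq scaleR_fseq.rep_eq

instantiation fseq :: real_inner
begin

definition inner_fseq :: "fseq \<Rightarrow> fseq \<Rightarrow> real"
  where "inner_fseq x y = (\<Sum>i | coord x i \<noteq> 0. coord x i * coord y i)"

definition norm_fseq :: "fseq \<Rightarrow> real"
  where "norm_fseq x = sqrt (inner x x)"

definition sgn_fseq :: "fseq \<Rightarrow> fseq"
  where "sgn_fseq x = x /\<^sub>R norm x"

definition dist_fseq :: "fseq \<Rightarrow> fseq \<Rightarrow> real"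
  where "dist_fseq x y = norm (x - y)"

definition uniformity_fseq :: "(fseq \<times> fseq) filter"
  where "uniformity_fseq = (INF e\<in>{0<..}. principal {(x, y). dist x y < e})"

definition open_fseq :: "fseq set \<Rightarrow> bool"
  where "open_fseq U \<longleftrightarrow> (\<forall>x\<in>U. \<forall>\<^sub>F (x', y) in uniformity. x' = x \<longrightarrow> y \<in> U)"

lemma inner_fseq_superset:
  assumes "finite A" "{i. coord x i \<noteq> 0} \<subseteq> A"
  shows "inner x y = (\<Sum>i\<in>A. coord x i * coord y i)"
  unfolding inner_fseq_def using assms by (intro sum.mono_neutral_left) auto

instance
proof
  fix x y z :: fseq and r :: real
  define A where
    "A = {i. coord x i \<noteq> 0} \<union> {i. coord y i \<noteq> 0} \<union> {i. coord z i \<noteq> 0}"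
  have A: "finite A"
    unfolding A_def by (intro finite_UnI finite_coord)
  show "inner x y = inner y x"
    by (subst (1 2) inner_fseq_superset[of A]) (auto simp: A mult.commute, auto simp: A_def)
  show "inner (x + y) z = inner x z + inner y z"
    by (subst (1 2 3) inner_fseq_superset[of A])
       (auto simp: A sum.distrib distrib_right, auto simp: A_def)
  show "inner (r *\<^sub>R x) y = r * inner x y"
    by (subst (1 2) inner_fseq_superset[of A])
       (auto simp: A sum_distrib_left mult.assoc, auto simp: A_def)
  show "0 \<le> inner x x"
    unfolding inner_fseq_def by (intro sum_nonneg) simp
  show "inner x x = 0 \<longleftrightarrow> x = 0"
    unfolding inner_fseq_def
    by (subst sum_nonneg_eq_0_iff) (auto simp: finite_coord intro: fseq_eqI)
  show "norm x = sqrt (inner x x)"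
    by (fact norm_fseq_def)
  show "sgn x = x /\<^sub>R norm x"
    by (fact sgn_fseq_def)
  show "dist x y = norm (x - y)"
    by (fact dist_fseq_def)
  show "uniformity = (INF e\<in>{0<..}. principal {(x :: fseq, y). dist x y < e})"
    by (fact uniformity_fseq_def)
  show "open U \<longleftrightarrow> (\<forall>x\<in>U. \<forall>\<^sub>F (x', y) in uniformity. x' = x \<longrightarrow> y \<in> U)" for U :: "fseq set"
    by (fact open_fseq_def)
qed

end

definition Rn :: "nat \<Rightarrow> fseq set"
  where "Rn d = {x. \<forall>i\<ge>d. coord x i = 0}"

lemma subspace_Rn: "subspace (Rn d)"
  by (auto simp: subspace_def Rn_def)

text \<open>\<open>Rn d\<close> is the space of all \<open>d\<close>-tuples of reals with the usual inner product and norm.\<close>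

lemma bij_betw_Rn: "bij_betw (\<lambda>x. restrict (coord x) {..<d}) (Rn d) ({..<d} \<rightarrow>\<^sub>E UNIV)"
proof (rule bij_betwI')
  fix x y assume xy: "x \<in> Rn d" "y \<in> Rn d"
  show "restrict (coord x) {..<d} = restrict (coord y) {..<d} \<longleftrightarrow> x = y"
  proof
    assume eq: "restrict (coord x) {..<d} = restrict (coord y) {..<d}"
    show "x = y"
    proof (rule fseq_eqI)
      fix i show "coord x i = coord y i"
        using xy fun_cong[OF eq, of i] by (cases "i < d") (auto simp: Rn_def)
    qed
  qed simp
next
  fix c :: "nat \<Rightarrow> real" assume c: "c \<in> {..<d} \<rightarrow>\<^sub>E UNIV"
  define x where "x = Abs_fseq (\<lambda>i. if i < d then c i else 0)"
  have x: "coord x = (\<lambda>i. if i < d then c i else 0)"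
    unfolding x_def by (rule Abs_fseq_inverse) (auto intro: finite_subset[of _ "{..<d}"])
  have "x \<in> Rn d" "c = restrict (coord x) {..<d}"
    using c by (auto simp: Rn_def x PiE_def extensional_def)
  then show "\<exists>x\<in>Rn d. c = restrict (coord x) {..<d}" by blast
qed auto

lemma inner_Rn:
  assumes "x \<in> Rn d"
  shows "inner x y = (\<Sum>i<d. coord x i * coord y i)"
  using assms by (intro inner_fseq_superset) (auto simp: Rn_def not_le[symmetric])

lemma norm_Rn:
  assumes "x \<in> Rn d"
  shows "norm x = L2_set (coord x) {..<d}"
  unfolding norm_eq_sqrt_inner L2_set_def inner_Rn[OF assms] by (simp add: power2_eq_square)


text \<open>
  The notions below are relative to a carrier \<open>V\<close> (used with \<open>V = Rn d\<close>); the values of \<open>f\<close> and of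
  its gradient outside \<open>V\<close> are irrelevant.
\<close>

definition is_gradient_on ::
    "'a::real_inner set \<Rightarrow> ('a \<Rightarrow> real) \<Rightarrow> ('a \<Rightarrow> 'a) \<Rightarrow> bool"
  where "is_gradient_on V f grad \<longleftrightarrow>
    (\<forall>x\<in>V. grad x \<in> V \<and> (f has_derivative (\<lambda>h. inner (grad x) h)) (at x within V))"

definition coercive_on :: "'a::real_inner set \<Rightarrow> ('a \<Rightarrow> real) \<Rightarrow> bool"
  where "coercive_on V f \<longleftrightarrow> filterlim f at_top (inf at_infinity (principal V))"

text \<open>
  \<open>Inf\<close> on the reals is only meaningful for sets that are bounded below; a coercive continuous
  function on \<open>Rn d\<close> is bounded below.
\<close>

definition infimum_on :: "'a::real_inner set \<Rightarrow> ('a \<Rightarrow> real) \<Rightarrow> real"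
  where "infimum_on V f = (INF x\<in>V. f x)"

definition near_opt :: "'a::real_inner set \<Rightarrow> ('a \<Rightarrow> real) \<Rightarrow> real \<Rightarrow> 'a set"
  where "near_opt V f \<delta> = {u\<in>V. f u - infimum_on V f \<le> \<delta>}"

definition glocally_smooth ::
    "'a::real_inner set \<Rightarrow> ('a \<Rightarrow> real) \<Rightarrow> ('a \<Rightarrow> 'a) \<Rightarrow> real \<Rightarrow> real \<Rightarrow> real \<Rightarrow> bool"
  where "glocally_smooth V f grad L Ls \<delta> \<longleftrightarrow>
    L-lipschitz_on V grad \<and> Ls-lipschitz_on (near_opt V f \<delta>) grad"

definition locally_strongly_convex ::
    "'a::real_inner set \<Rightarrow> ('a \<Rightarrow> real) \<Rightarrow> ('a \<Rightarrow> 'a) \<Rightarrow> real \<Rightarrow> real \<Rightarrow> bool"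
  where "locally_strongly_convex V f grad \<mu> \<delta> \<longleftrightarrow>
    (\<forall>u\<in>near_opt V f \<delta>. \<forall>v\<in>near_opt V f \<delta>.
      f v \<ge> f u + inner (grad u) (v - u) + \<mu> / 2 * (norm (v - u))\<^sup>2)"

definition minimizers_on :: "'a::real_inner set \<Rightarrow> ('a \<Rightarrow> real) \<Rightarrow> 'a set"
  where "minimizers_on V f = {w\<in>V. \<forall>v\<in>V. f w \<le> f v}"

text \<open>
  The greatest element of a set of reals; it is unspecified if there is none. For coercive
  continuous \<open>f\<close> on \<open>Rn d\<close> it exists whenever \<open>\<rho>\<close> is a value of \<open>f\<close>, by compactness.
\<close>

definition R2 :: "'a::real_inner set \<Rightarrow> ('a \<Rightarrow> real) \<Rightarrow> real \<Rightarrow> real"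
  where "R2 V f \<rho> =
    (GREATEST r. r \<in> {(norm (w - ws))\<^sup>2 | w ws. w \<in> V \<and> ws \<in> minimizers_on V f \<and> f w \<le> \<rho>})"

definition gd_exact_line_search ::
    "('a::real_inner \<Rightarrow> real) \<Rightarrow> ('a \<Rightarrow> 'a) \<Rightarrow> (nat \<Rightarrow> 'a) \<Rightarrow> (nat \<Rightarrow> real) \<Rightarrow> bool"
  where "gd_exact_line_search f grad w \<eta> \<longleftrightarrow>
    (\<forall>t. w (Suc t) = w t - \<eta> t *\<^sub>R grad (w t) \<and>
         is_arg_min (\<lambda>s. f (w t - s *\<^sub>R grad (w t))) (\<lambda>_. True) (\<eta> t))"

end

theory Submission
  imports Defs
begin

text \<open>
  One estimate drives the proof (\<open>line_search_decrease\<close>): if the gradient \<open>g\<close> at the current iterate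
  \<open>x\<close> belongs to a convex function and the gradient map is \<open>K\<close>-Lipschitz on a convex set containing
  both \<open>x\<close> and the next iterate \<open>y\<close>, then exact line search lowers \<open>f\<close> by at least
  \<open>\<parallel>g\<parallel>\<^sup>2 / (4 K)\<close>. Line search never increases \<open>f\<close>, so once an iterate satisfies \<open>f - f\<^sub>* \<le> \<delta>\<close> all
  later ones do. The estimate can therefore be used with \<open>K = L\<close> on the whole space, and with
  \<open>K = L\<^sub>*\<close> as soon as the iterates have entered the region near the minimizer: the step sizes adapt
  by themselves, without knowledge of either constant.

  Write \<open>a\<^sub>t = f(w\<^sub>t) - f\<^sub>*\<close>. By convexity \<open>a\<^sub>t \<le> \<parallel>\<nabla>f(w\<^sub>t)\<parallel> R\<close>, because the iterates stay in the initial
  sublevel set. Hence \<open>a\<^sub>t\<^sub>+\<^sub>1 \<le> a\<^sub>t - a\<^sub>t\<^sup>2 / (4 L R\<^sup>2)\<close>, which gives \<open>t a\<^sub>t \<le> 4 L R\<^sup>2\<close>, and \<open>\<lceil>4 L R\<^sup>2 / \<delta>\<rceil>\<close>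
  steps reach \<open>a\<^sub>t \<le> \<delta>\<close>. From there on local strong convexity gives
  \<open>2 \<mu>\<^sub>* a\<^sub>t \<le> \<parallel>\<nabla>f(w\<^sub>t)\<parallel>\<^sup>2\<close> (the Polyak-Lojasiewicz inequality), so
  \<open>a\<^sub>t\<close> shrinks by the factor \<open>1 - \<mu>\<^sub>* / (2 L\<^sub>*)\<close> in each step and
  \<open>2 (L\<^sub>* / \<mu>\<^sub>*) log(\<delta> / \<epsilon>)\<close> further steps suffice. Since \<open>f(w\<^sub>0) - f\<^sub>* > \<delta>\<close> forces \<open>L R\<^sup>2 / \<delta> > 1\<close>, the
  rounding in the first phase is absorbed by the constant \<open>C = 5\<close>.

  The complexity bound holds on every subspace on which the sublevel sets of \<open>f\<close> are compact;
  coercivity supplies this on \<open>Rn d\<close>, where it makes \<open>f\<close> attain its minimum and makes the maximum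
  that defines \<open>R\<^sup>2\<close> exist.
\<close>

section \<open>Differentiable convex functions on a subspace\<close>

lemma is_gradient_on_imp_continuous_on:
  "is_gradient_on V f grad \<Longrightarrow> continuous_on V f"
  unfolding is_gradient_on_def
  by (meson continuous_on_eq_continuous_within has_derivative_continuous)

lemma has_real_derivative_along_line:
  assumes V: "subspace V" and grad: "is_gradient_on V f grad"
    and x: "x \<in> V" and h: "h \<in> V"
  shows "((\<lambda>t. f (x + t *\<^sub>R h)) has_real_derivative inner (grad (x + t *\<^sub>R h)) h) (at t)"
proof -
  have line: "x + s *\<^sub>R h \<in> V" for s
    using V x h by (simp add: subspace_add subspace_scale)
  have "(f has_derivative (\<lambda>k. inner (grad (x + t *\<^sub>R h)) k))
      (at (x + t *\<^sub>R h) within range (\<lambda>s. x + s *\<^sub>R h))"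
    using grad line unfolding is_gradient_on_def
    by (blast intro: has_derivative_subset)
  moreover have "((\<lambda>s. x + s *\<^sub>R h) has_derivative (\<lambda>s. s *\<^sub>R h)) (at t)"
    by (auto intro!: derivative_eq_intros)
  ultimately have "((\<lambda>t. f (x + t *\<^sub>R h)) has_derivative
      (\<lambda>s. inner (grad (x + t *\<^sub>R h)) (s *\<^sub>R h))) (at t)"
    using has_derivative_in_compose[of "\<lambda>s. x + s *\<^sub>R h" "\<lambda>s. s *\<^sub>R h" t UNIV f] by blast
  then show ?thesis
    by (simp add: has_field_derivative_def mult.commute[of _ "inner _ _"])
qed

text \<open>
  Both facts below are about the restriction of \<open>f\<close> to a line, where the one-variable theory applies:
  a convex function lies above its tangents, and the derivative vanishes at a minimum.
\<close>

lemma gradient_inequality: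
  assumes V: "subspace V" and grad: "is_gradient_on V f grad" and conv: "convex_on V f"
    and x: "x \<in> V" and y: "y \<in> V"
  shows "f x + inner (grad x) (y - x) \<le> f y"
proof -
  define \<phi> where "\<phi> = (\<lambda>t. f (x + t *\<^sub>R (y - x)))"
  have h: "y - x \<in> V" by (rule subspace_diff[OF V y x])
  have line: "x + s *\<^sub>R (y - x) \<in> V" for s
    using V x h by (simp add: subspace_add subspace_scale)
  have "convex_on UNIV \<phi>"
  proof (rule convex_onI)
    fix t a b :: real assume t: "0 < t" "t < 1"
    have "x + ((1 - t) *\<^sub>R a + t *\<^sub>R b) *\<^sub>R (y - x)
        = (1 - t) *\<^sub>R (x + a *\<^sub>R (y - x)) + t *\<^sub>R (x + b *\<^sub>R (y - x))"
      by (simp add: algebra_simps)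
    then show "\<phi> ((1 - t) *\<^sub>R a + t *\<^sub>R b) \<le> (1 - t) * \<phi> a + t * \<phi> b"
      unfolding \<phi>_def using convex_onD[OF conv, of t] t line by simp
  qed simp
  moreover have "(\<phi> has_real_derivative inner (grad x) (y - x)) (at 0)"
    unfolding \<phi>_def using has_real_derivative_along_line[OF V grad x h, of 0] by simp
  ultimately have "\<phi> 1 - \<phi> 0 \<ge> inner (grad x) (y - x) * (1 - 0)"
    by (intro convex_on_imp_above_tangent[of UNIV]) auto
  then show ?thesis by (simp add: \<phi>_def)
qed

lemma line_minimum_stationary:
  assumes V: "subspace V" and grad: "is_gradient_on V f grad"
    and x: "x \<in> V" and h: "h \<in> V"
    and min: "\<And>s. f (x + t *\<^sub>R h) \<le> f (x + s *\<^sub>R h)"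
  shows "inner (grad (x + t *\<^sub>R h)) h = 0"
  using DERIV_local_min[OF has_real_derivative_along_line[OF V grad x h, of t], of 1] min by simp

lemma gradient_zero_at_minimizer:
  assumes V: "subspace V" and grad: "is_gradient_on V f grad"
    and x: "x \<in> minimizers_on V f"
  shows "grad x = 0"
proof -
  have xV: "x \<in> V" and gV: "grad x \<in> V"
    using x grad by (auto simp: minimizers_on_def is_gradient_on_def)
  have "f (x + 0 *\<^sub>R grad x) \<le> f (x + s *\<^sub>R grad x)" for s
    using x V xV gV by (simp add: minimizers_on_def subspace_add subspace_scale)
  from line_minimum_stationary[OF V grad xV gV this] show ?thesis by simp
qed

lemma convex_near_opt:
  assumes "convex_on V f"
  shows "convex (near_opt V f \<delta>)"
proof (rule convexI)
  fix x y and a b :: real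
  assume x: "x \<in> near_opt V f \<delta>" and y: "y \<in> near_opt V f \<delta>"
    and ab: "0 \<le> a" "0 \<le> b" "a + b = 1"
  let ?c = "infimum_on V f + \<delta>"
  have xy: "x \<in> V" "y \<in> V" "f x \<le> ?c" "f y \<le> ?c"
    using x y by (auto simp: near_opt_def)
  have "f (a *\<^sub>R x + b *\<^sub>R y) \<le> a * f x + b * f y"
    using assms xy ab by (simp add: convex_on_def)
  also have "\<dots> \<le> ?c"
    using convex_bound_le[of "f x" ?c "f y" a b] xy ab by simp
  finally show "a *\<^sub>R x + b *\<^sub>R y \<in> near_opt V f \<delta>"
    using convexD[OF convex_on_imp_convex[OF assms] xy(1,2) ab] by (simp add: near_opt_def)
qed

section \<open>The decrease of one exact line search step\<close>

text \<open>
  The exact step cannot be short: at \<open>y\<close> the new gradient is orthogonal to \<open>grad x\<close>, so along the step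
  the gradient has changed by at least \<open>\<parallel>grad x\<parallel>\<close>, and the Lipschitz bound forces \<open>\<eta> \<ge> 1/K\<close>. The
  segment from \<open>x\<close> to \<open>y\<close> thus contains the point reached by the fixed step \<open>1/(2K)\<close>, whose
  value is at least \<open>f y\<close>. At that point the inner product of the gradient with \<open>grad x\<close> is still at
  least \<open>\<parallel>grad x\<parallel>\<^sup>2/2\<close>, and the gradient inequality there bounds \<open>f x\<close> from below. Only
  the segment matters, so \<open>S\<close> can be as small as the region of local smoothness.
\<close>

lemma line_search_decrease:
  assumes V: "subspace V" and grad: "is_gradient_on V f grad" and conv: "convex_on V f"
    and S: "convex S" "S \<subseteq> V" and K: "K > 0" and lip: "K-lipschitz_on S grad"
    and x: "x \<in> S" and y: "y \<in> S" and y_def: "y = x - \<eta> *\<^sub>R grad x"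
    and min: "\<And>s. f y \<le> f (x - s *\<^sub>R grad x)"
  shows "f y \<le> f x - (norm (grad x))\<^sup>2 / (4 * K)"
proof (cases "grad x = 0")
  case True
  then show ?thesis by (simp add: y_def)
next
  case False
  define g where "g = grad x"
  have g: "norm g > 0" using False by (simp add: g_def)
  have xV: "x \<in> V" and yV: "y \<in> V" and gV: "g \<in> V"
    using x y S grad by (auto simp: g_def is_gradient_on_def)
  have bound: "inner (g - grad v) g \<le> K * norm (x - v) * norm g" if "v \<in> S" for v
  proof -
    have "inner (g - grad v) g \<le> norm (g - grad v) * norm g"
      by (rule norm_cauchy_schwarz)
    also have "\<dots> \<le> K * norm (x - v) * norm g"
      using lipschitz_onD[OF lip x that] by (intro mult_right_mono) (auto simp: dist_norm g_def)
    finally show ?thesis .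
  qed
  have "\<eta> \<ge> 0"
  proof -
    have "f x - \<eta> * (norm g)\<^sup>2 \<le> f y"
      using gradient_inequality[OF V grad conv xV yV]
      by (simp add: y_def g_def power2_norm_eq_inner)
    also have "f y \<le> f x" using min[of 0] by simp
    finally show ?thesis using g by (simp add: zero_le_mult_iff)
  qed
  have "inner (grad y) (- g) = 0"
    using line_minimum_stationary[OF V grad xV subspace_neg[OF V gV], of \<eta>] min
    by (simp add: y_def g_def)
  then have "(norm g)\<^sup>2 \<le> K * \<eta> * (norm g)\<^sup>2"
    using bound[OF y] \<open>\<eta> \<ge> 0\<close>
    by (simp add: inner_diff_left y_def flip: g_def) (simp add: power2_norm_eq_inner[symmetric] power2_eq_square)
  then have \<eta>: "1 \<le> K * \<eta>" using g by simp
  \<comment> \<open>The trial step \<open>1/(2K)\<close> maximises the guaranteed decrease \<open>s(1 - K s)\<close>; being shorter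
    than \<open>\<eta>\<close>, it stays on the segment from \<open>x\<close> to \<open>y\<close>, hence in \<open>S\<close>.\<close>
  define s where "s = 1 / (2 * K)"
  define v where "v = x - s *\<^sub>R g"
  have s: "s > 0" "K * s = 1 / 2" using K by (auto simp: s_def)
  have "\<eta> > 0" using \<eta> K \<open>\<eta> \<ge> 0\<close> by (cases "\<eta> = 0") auto
  have "s \<le> \<eta>" using \<eta> K by (simp add: s_def field_simps)
  have "v = (1 - s / \<eta>) *\<^sub>R x + (s / \<eta>) *\<^sub>R y"
    using \<open>\<eta> > 0\<close> by (simp add: v_def y_def g_def algebra_simps)
  then have v: "v \<in> S"
    using convexD_alt[OF S(1) x y, of "s / \<eta>"] \<open>s \<le> \<eta>\<close> s \<open>\<eta> > 0\<close> by simp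
  have "(norm g)\<^sup>2 - inner (grad v) g \<le> K * s * (norm g)\<^sup>2"
    using bound[OF v] s
    by (simp add: v_def inner_diff_left power2_norm_eq_inner) (simp add: power2_norm_eq_inner[symmetric] power2_eq_square)
  then have "(norm g)\<^sup>2 / 2 \<le> inner (grad v) g" using s by simp
  then have "s * ((norm g)\<^sup>2 / 2) \<le> s * inner (grad v) g"
    using s by (intro mult_left_mono) auto
  moreover have "f v + s * inner (grad v) g \<le> f x"
    using gradient_inequality[OF V grad conv, of v x] v S xV by (auto simp: v_def)
  moreover have "f y \<le> f v" using min[of s] by (simp add: v_def g_def)
  ultimately have "f y \<le> f x - s * ((norm g)\<^sup>2 / 2)" by linarith
  then show ?thesis by (simp add: s_def g_def)
qed

section \<open>Two scalar recurrences\<close>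

text \<open>
  With \<open>x = a n / c\<close> the induction step asks for \<open>(n + 1) x (1 - x) \<le> 1\<close>; the induction hypothesis
  \<open>n x \<le> 1\<close> bounds the left-hand side by \<open>(1 + x) (1 - x)\<close>.
\<close>

lemma quadratic_recurrence_bound:
  fixes a :: "nat \<Rightarrow> real"
  assumes c: "c > 0" and nonneg: "\<And>n. 0 \<le> a n"
    and step: "\<And>n. a (Suc n) \<le> a n - (a n)\<^sup>2 / c"
  shows "real n * a n \<le> c"
proof (induction n)
  case 0
  then show ?case using c by simp
next
  case (Suc n)
  define x where "x = a n / c"
  have x: "0 \<le> x" "real n * x \<le> 1" using c nonneg Suc by (auto simp: x_def field_simps)
  have "a (Suc n) \<le> c * (x * (1 - x))"
  proof -
    have "c * (x * (1 - x)) = a n - (a n)\<^sup>2 / c"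
      using c by (simp add: x_def field_simps power2_eq_square)
    then show ?thesis using step[of n] by simp
  qed
  moreover have "x \<le> 1"
  proof -
    have "0 \<le> x * (1 - x)"
      using calculation nonneg[of "Suc n"] c by (meson order_trans zero_le_mult_iff not_less)
    then show ?thesis using x(1) by (cases "x = 0") (auto simp: zero_le_mult_iff)
  qed
  ultimately have "real (Suc n) * a (Suc n) \<le> c * ((real n * x + x) * (1 - x))"
    using mult_left_mono[of "a (Suc n)" "c * (x * (1 - x))" "real (Suc n)"]
    by (simp add: algebra_simps)
  also have "\<dots> \<le> c * ((1 + x) * (1 - x))"
    using c x \<open>x \<le> 1\<close> by (intro mult_left_mono mult_right_mono) auto
  also have "\<dots> \<le> c * 1"
    using c by (intro mult_left_mono) (auto simp: algebra_simps)
  finally show ?case by simp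
qed

lemma linear_recurrence_bound:
  fixes a :: "nat \<Rightarrow> real"
  assumes nonneg: "\<And>n. 0 \<le> a n" and step: "\<And>n. a (Suc n) \<le> (1 - q) * a n"
  shows "a n \<le> exp (- q * real n) * a 0"
proof (induction n)
  case (Suc n)
  have "a (Suc n) \<le> (1 - q) * a n" by (rule step)
  also have "\<dots> \<le> exp (- q) * a n"
    using exp_ge_add_one_self[of "- q"] nonneg by (intro mult_right_mono) auto
  also have "\<dots> \<le> exp (- q) * (exp (- q * real n) * a 0)"
    using Suc by (intro mult_left_mono) auto
  also have "\<dots> = exp (- q * real (Suc n)) * a 0"
    by (simp add: exp_add[symmetric] mult.assoc[symmetric] algebra_simps)
  finally show ?case .
qed simp

section \<open>Compactness in coordinate space\<close>

lemma coord_le_norm: "\<bar>coord x i\<bar> \<le> norm x"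
proof (cases "coord x i = 0")
  case False
  have "(coord x i)\<^sup>2 \<le> inner x x"
    unfolding inner_fseq_def power2_eq_square
    using False by (intro member_le_sum[of i _ "\<lambda>i. coord x i * coord x i"]) (auto simp: finite_coord)
  then have "(coord x i)\<^sup>2 \<le> (norm x)\<^sup>2" by (simp add: power2_norm_eq_inner)
  then show ?thesis using abs_le_square_iff[of "coord x i" "norm x"] by simp
qed simp

text \<open>
  The ambient space of finitely supported sequences is infinite-dimensional, so bounded closed sets
  are not compact in general. Inside \<open>Rn d\<close> they are: the box in \<open>Rn (Suc d)\<close> is a continuous
  image of the product of the box in \<open>Rn d\<close> with an interval.
\<close>

lemma compact_box_Rn: "compact {x \<in> Rn d. \<forall>i. \<bar>coord x i\<bar> \<le> B}"
proof (induction d)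
  case 0
  have "Rn 0 = {0}" by (auto simp: Rn_def intro: fseq_eqI)
  then have "{x \<in> Rn 0. \<forall>i. \<bar>coord x i\<bar> \<le> B} \<subseteq> {0}" by auto
  then show ?case by (intro finite_imp_compact) (rule finite_subset, auto)
next
  case (Suc d)
  define e where "e = Abs_fseq (\<lambda>i. if i = d then 1 else 0)"
  have e: "coord e i = (if i = d then 1 else 0)" for i
    unfolding e_def by (subst Abs_fseq_inverse) auto
  let ?A = "{x \<in> Rn d. \<forall>i. \<bar>coord x i\<bar> \<le> B}"
  define h where "h = (\<lambda>p. fst p + snd p *\<^sub>R e)"
  have "{x \<in> Rn (Suc d). \<forall>i. \<bar>coord x i\<bar> \<le> B} = h ` (?A \<times> {-B..B})"
  proof (intro equalityI subsetI)
    fix x assume x: "x \<in> {x \<in> Rn (Suc d). \<forall>i. \<bar>coord x i\<bar> \<le> B}"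
    define t where "t = coord x d"
    have t: "t \<in> {-B..B}" using x abs_le_iff[of t B] by (auto simp: t_def)
    have B: "0 \<le> B" using t by simp
    have zero: "coord x i = 0" if "i > d" for i
      using x that by (simp add: Rn_def)
    have "x - t *\<^sub>R e \<in> ?A" using x B zero by (simp add: Rn_def e t_def)
    moreover have "x = h (x - t *\<^sub>R e, t)" by (simp add: h_def)
    ultimately show "x \<in> h ` (?A \<times> {-B..B})" using t by blast
  next
    fix x assume "x \<in> h ` (?A \<times> {-B..B})"
    then obtain y t where y: "y \<in> ?A" and t: "t \<in> {-B..B}" and x: "x = y + t *\<^sub>R e"
      unfolding h_def by (elim imageE SigmaE) simp
    have "coord y d = 0" using y by (simp add: Rn_def)
    then show "x \<in> {x \<in> Rn (Suc d). \<forall>i. \<bar>coord x i\<bar> \<le> B}"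
      using y t by (auto simp: x Rn_def e)
  qed
  moreover have "compact (?A \<times> {-B..B})" by (intro compact_Times Suc compact_Icc)
  moreover have "continuous_on (?A \<times> {-B..B}) h"
    unfolding h_def by (intro continuous_intros)
  ultimately show ?case by (simp only: compact_continuous_image)
qed

lemma compact_sublevel_Rn:
  assumes cont: "continuous_on (Rn d) f" and coer: "coercive_on (Rn d) f"
  shows "compact {x \<in> Rn d. f x \<le> \<rho>}"
proof -
  have "\<forall>\<^sub>F x in inf at_infinity (principal (Rn d)). \<rho> < f x"
    using coer unfolding coercive_on_def filterlim_at_top_dense by blast
  then obtain B where B: "\<And>x. x \<in> Rn d \<Longrightarrow> B \<le> norm x \<Longrightarrow> \<rho> < f x"
    unfolding eventually_inf_principal eventually_at_infinity by blast
  let ?K = "{x \<in> Rn d. \<forall>i. \<bar>coord x i\<bar> \<le> B}"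
  have K: "compact ?K" by (rule compact_box_Rn)
  have "\<bar>coord x i\<bar> \<le> B" if "x \<in> Rn d" "f x \<le> \<rho>" for x i
    using B[of x] that coord_le_norm[of x i] by (cases "B \<le> norm x") auto
  then have "{x \<in> Rn d. f x \<le> \<rho>} = ?K \<inter> f -` {..\<rho>}" by auto
  moreover have "closed (?K \<inter> f -` {..\<rho>})"
    using continuous_on_subset[OF cont] compact_imp_closed[OF K]
    by (intro continuous_closed_preimage) auto
  ultimately show ?thesis using K compact_Int_closed[of ?K "?K \<inter> f -` {..\<rho>}"]
    by (simp add: Int_absorb1)
qed

lemma minimizer_exists:
  assumes cont: "continuous_on V f" and comp: "compact {x \<in> V. f x \<le> f x0}" and x0: "x0 \<in> V"
  shows "\<exists>z. z \<in> minimizers_on V f"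
proof -
  have "\<exists>z\<in>{x \<in> V. f x \<le> f x0}. \<forall>y\<in>{x \<in> V. f x \<le> f x0}. f z \<le> f y"
    using x0 continuous_on_subset[OF cont] by (intro continuous_attains_inf comp) auto
  then show ?thesis unfolding minimizers_on_def
    by (smt (verit) mem_Collect_eq)
qed

lemma infimum_on_eq:
  assumes "z \<in> minimizers_on V f"
  shows "infimum_on V f = f z"
  unfolding infimum_on_def using assms by (intro cInf_eq_minimum) (auto simp: minimizers_on_def)

text \<open>
  Compactness is what gives \<open>R2\<close> its meaning: the set of squared distances is a continuous image of a
  compact set and so has a greatest element.
\<close>

lemma norm_le_R2:
  assumes comp: "\<And>\<rho>. compact {x \<in> V. f x \<le> \<rho>}"
    and w: "w \<in> V" "f w \<le> \<rho>" and z: "z \<in> minimizers_on V f"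
  shows "(norm (w - z))\<^sup>2 \<le> R2 V f \<rho>"
proof -
  let ?A = "{x \<in> V. f x \<le> \<rho>}" and ?M = "minimizers_on V f"
  let ?D = "{(norm (w - ws))\<^sup>2 | w ws. w \<in> V \<and> ws \<in> ?M \<and> f w \<le> \<rho>}"
  have "?M = {x \<in> V. f x \<le> f z}"
    using z unfolding minimizers_on_def by force
  then have "compact (?A \<times> ?M)" using comp by (simp add: compact_Times)
  then have "compact ((\<lambda>p. (norm (fst p - snd p))\<^sup>2) ` (?A \<times> ?M))"
    by (intro compact_continuous_image continuous_intros)
  moreover have D: "?D = (\<lambda>p. (norm (fst p - snd p))\<^sup>2) ` (?A \<times> ?M)"
    by force
  moreover have mem: "(norm (w - z))\<^sup>2 \<in> ?D" using w z by blast
  ultimately obtain r where r: "r \<in> ?D" "\<And>y. y \<in> ?D \<Longrightarrow> y \<le> r"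
    using compact_attains_sup[of ?D] by (metis (no_types, lifting) empty_iff)
  then have "R2 V f \<rho> = r" unfolding R2_def by (intro Greatest_equality) auto
  then show ?thesis using r mem by simp
qed

section \<open>The two phases of gradient descent\<close>

text \<open>
  The only trace of finite dimension is the compactness of the sublevel sets, a qualitative
  condition; this is why the constant \<open>5\<close> can be chosen uniformly in \<open>d\<close>.
\<close>

lemma gd_exact_line_search_complexity:
  assumes V: "subspace V" and comp: "\<And>\<rho>. compact {x \<in> V. f x \<le> \<rho>}"
    and pos: "L > 0" "Ls > 0" "\<delta> > 0" "\<mu> > 0" "\<epsilon> > 0"
    and grad: "is_gradient_on V f grad" and smooth: "glocally_smooth V f grad L Ls \<delta>"
    and strong: "locally_strongly_convex V f grad \<mu> \<delta>" and conv: "convex_on V f"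
    and w0V: "w 0 \<in> V" and w0: "f (w 0) - infimum_on V f > \<delta>"
    and gd: "gd_exact_line_search f grad w \<eta>"
    and T: "real T \<ge> 5 * (L / \<delta> * R2 V f (f (w 0)) + Ls / \<mu> * ln (\<delta> / \<epsilon>))"
    and \<epsilon>: "\<epsilon> < \<delta>"
  shows "f (w T) - infimum_on V f \<le> \<epsilon>"
proof -
  define R where "R = R2 V f (f (w 0))"
  define N where "N = near_opt V f \<delta>"
  define a where "a = (\<lambda>t. f (w t) - infimum_on V f)"
  have cont: "continuous_on V f"
    using grad by (rule is_gradient_on_imp_continuous_on)
  obtain z where z: "z \<in> minimizers_on V f"
    using minimizer_exists[OF cont comp w0V] by blast
  have zV: "z \<in> V" and a_eq: "a t = f (w t) - f z" for t
    using z infimum_on_eq[OF z] by (auto simp: minimizers_on_def a_def)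
  have wSuc: "w (Suc t) = w t - \<eta> t *\<^sub>R grad (w t)"
    and wmin: "f (w (Suc t)) \<le> f (w t - s *\<^sub>R grad (w t))" for t s
    using gd by (auto simp: gd_exact_line_search_def is_arg_min_def not_less)
  have wV: "w t \<in> V" for t
    using w0V V grad
    by (induction t) (auto simp: wSuc is_gradient_on_def subspace_diff subspace_scale)
  have mono: "a (Suc t) \<le> a t" for t using wmin[of t 0] by (simp add: a_def)
  have antimono: "a t \<le> a s" if "s \<le> t" for s t
    using decseqD[OF decseq_SucI[of a, OF mono] that] .
  have a_nonneg: "0 \<le> a t" for t using z wV by (simp add: a_eq minimizers_on_def)
  have dist_R: "(norm (w t - z))\<^sup>2 \<le> R" for t
    unfolding R_def using wV antimono[of 0 t] z by (intro norm_le_R2 comp) (auto simp: a_def)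
  have a_le_grad: "a t \<le> norm (grad (w t)) * norm (w t - z)" for t
  proof -
    have "a t \<le> inner (grad (w t)) (w t - z)"
      using gradient_inequality[OF V grad conv wV zV, of t] by (simp add: a_eq inner_diff_right)
    also have "\<dots> \<le> norm (grad (w t)) * norm (w t - z)" by (rule norm_cauchy_schwarz)
    finally show ?thesis .
  qed
  have lipL: "L-lipschitz_on V grad" and lipN: "Ls-lipschitz_on N grad"
    using smooth by (auto simp: glocally_smooth_def N_def)
  \<comment> \<open>\<open>R\<close> is the squared radius. Because \<open>L R/\<delta>\<close> exceeds 1, rounding up the length of the first phase
    costs only a constant factor.\<close>
  have "\<delta> < L * R"
  proof -
    have "norm (grad (w 0)) \<le> L * norm (w 0 - z)"
      using lipschitz_onD[OF lipL w0V zV] gradient_zero_at_minimizer[OF V grad z]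
      by (simp add: dist_norm)
    then have "norm (grad (w 0)) * norm (w 0 - z) \<le> L * norm (w 0 - z) * norm (w 0 - z)"
      by (intro mult_right_mono) auto
    also have "\<dots> = L * (norm (w 0 - z))\<^sup>2" by (simp add: power2_eq_square)
    also have "\<dots> \<le> L * R" using dist_R pos by (intro mult_left_mono) auto
    finally show ?thesis using a_le_grad[of 0] w0 by (simp add: a_def)
  qed
  then have "0 < L * R" using pos by linarith
  then have R: "R > 0" using pos by (simp add: zero_less_mult_iff)

  \<comment> \<open>First phase: sublinear decrease, from convexity and the global constant \<open>L\<close>\<close>
  have "a (Suc t) \<le> a t - (a t)\<^sup>2 / (4 * L * R)" for t
  proof -
    have "f (w (Suc t)) \<le> f (w t) - (norm (grad (w t)))\<^sup>2 / (4 * L)"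
      by (rule line_search_decrease[OF V grad conv subspace_imp_convex[OF V] subset_refl pos(1)
            lipL wV wV wSuc wmin])
    then have dec: "a (Suc t) \<le> a t - (norm (grad (w t)))\<^sup>2 / (4 * L)" by (simp add: a_def)
    have "(a t)\<^sup>2 \<le> (norm (grad (w t)) * norm (w t - z))\<^sup>2"
      using a_le_grad a_nonneg by (intro power_mono) auto
    also have "\<dots> \<le> (norm (grad (w t)))\<^sup>2 * R"
      unfolding power_mult_distrib using dist_R by (intro mult_left_mono) auto
    finally have "(a t)\<^sup>2 / (4 * L * R) \<le> (norm (grad (w t)))\<^sup>2 / (4 * L)"
      using pos R by (simp add: field_simps)
    then show ?thesis using dec by linarith
  qed
  then have phase1: "real n * a n \<le> 4 * L * R" for n
    using pos R a_nonneg by (intro quadratic_recurrence_bound) auto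
  define n where "n = nat \<lceil>4 * (L / \<delta> * R)\<rceil>"
  have x1: "L / \<delta> * R \<ge> 1" using \<open>\<delta> < L * R\<close> pos by (simp add: field_simps)
  have n: "4 * (L / \<delta> * R) \<le> real n" "real n \<le> 5 * (L / \<delta> * R)"
    using x1 unfolding n_def by linarith+
  have "a n \<le> \<delta>"
  proof -
    have "4 * (L / \<delta> * R) * a n \<le> real n * a n"
      using n a_nonneg by (intro mult_right_mono) auto
    also have "\<dots> \<le> 4 * (L / \<delta> * R) * \<delta>" using phase1[of n] pos by simp
    finally show ?thesis by (rule mult_left_le_imp_le) (use x1 in linarith)
  qed
  then have aN: "a (n + k) \<le> \<delta>" for k using antimono[of n "n + k"] by simp
  then have wN: "w (n + k) \<in> N" for k using wV by (simp add: N_def near_opt_def a_def)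

  \<comment> \<open>Second phase: linear decrease, from strong convexity and the local constant \<open>L\<^sub>*\<close>\<close>
  define q where "q = \<mu> / (2 * Ls)"
  have zN: "z \<in> N" using zV infimum_on_eq[OF z] pos by (simp add: N_def near_opt_def)
  have "a (n + Suc k) \<le> (1 - q) * a (n + k)" for k
  proof -
    let ?w = "w (n + k)"
    have "f (w (Suc (n + k))) \<le> f ?w - (norm (grad ?w))\<^sup>2 / (4 * Ls)"
      by (rule line_search_decrease[OF V grad conv convex_near_opt[OF conv, of \<delta>, folded N_def] _
            pos(2) lipN wN _ wSuc wmin])
         (use wN[of "Suc k"] in \<open>auto simp: N_def near_opt_def\<close>)
    then have dec: "a (n + Suc k) \<le> a (n + k) - (norm (grad ?w))\<^sup>2 / (4 * Ls)"
      by (simp add: a_def)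
    have "f ?w + inner (grad ?w) (z - ?w) + \<mu> / 2 * (norm (z - ?w))\<^sup>2 \<le> f z"
      using strong wN zN by (auto simp: locally_strongly_convex_def N_def)
    moreover have "- (norm (grad ?w) * norm (z - ?w)) \<le> inner (grad ?w) (z - ?w)"
      using norm_cauchy_schwarz[of "- grad ?w" "z - ?w"] by simp
    ultimately have "a (n + k) \<le> norm (grad ?w) * norm (z - ?w) - \<mu> / 2 * (norm (z - ?w))\<^sup>2"
      by (simp add: a_eq)
    then have "2 * \<mu> * a (n + k)
        \<le> 2 * \<mu> * (norm (grad ?w) * norm (z - ?w) - \<mu> / 2 * (norm (z - ?w))\<^sup>2)"
      using pos by (intro mult_left_mono) auto
    also have "\<dots> = (norm (grad ?w))\<^sup>2 - (norm (grad ?w) - \<mu> * norm (z - ?w))\<^sup>2"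
      by (simp add: power2_eq_square algebra_simps)
    also have "\<dots> \<le> (norm (grad ?w))\<^sup>2" by simp
    finally have "2 * \<mu> * a (n + k) \<le> (norm (grad ?w))\<^sup>2" .
    then have "q * a (n + k) \<le> (norm (grad ?w))\<^sup>2 / (4 * Ls)"
      using pos by (simp add: q_def field_simps)
    then show ?thesis using dec by (simp add: algebra_simps)
  qed
  then have phase2: "a (n + k) \<le> exp (- q * real k) * a n" for k
    using linear_recurrence_bound[of "\<lambda>k. a (n + k)" q k] a_nonneg by simp

  have lnpos: "0 \<le> ln (\<delta> / \<epsilon>)" using \<epsilon> pos by simp
  have yp: "0 \<le> Ls / \<mu> * ln (\<delta> / \<epsilon>)" using lnpos pos by simp
  have nT: "n \<le> T" and k: "2 * (Ls / \<mu> * ln (\<delta> / \<epsilon>)) \<le> real (T - n)"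
  proof -
    have "real n + 2 * (Ls / \<mu> * ln (\<delta> / \<epsilon>)) \<le> real T"
      using T n(2) yp unfolding R_def[symmetric] distrib_left by linarith
    then show "n \<le> T" "2 * (Ls / \<mu> * ln (\<delta> / \<epsilon>)) \<le> real (T - n)" using yp by linarith+
  qed
  have "ln (\<delta> / \<epsilon>) = q * (2 * (Ls / \<mu> * ln (\<delta> / \<epsilon>)))" using pos by (simp add: q_def)
  also have "\<dots> \<le> q * real (T - n)"
    using k pos by (intro mult_left_mono) (auto simp: q_def)
  finally have "exp (- q * real (T - n)) \<le> exp (- ln (\<delta> / \<epsilon>))" by simp
  also have "\<dots> = \<epsilon> / \<delta>" using pos by (simp add: exp_minus)
  finally have "exp (- q * real (T - n)) * a n \<le> \<epsilon> / \<delta> * \<delta>"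
    using \<open>a n \<le> \<delta>\<close> a_nonneg pos by (intro mult_mono) auto
  then show ?thesis using phase2[of "T - n"] nT pos by (simp add: a_def)
qed

theorem theorem5:
  shows "\<exists>C::real. C > 0 \<and>
    (\<forall>(d::nat) (f :: fseq \<Rightarrow> real) (grad :: fseq \<Rightarrow> fseq)
      (L::real) (Ls::real) (\<delta>::real) (\<mu>::real) (\<epsilon>::real)
      (w0 :: fseq) (w :: nat \<Rightarrow> fseq) (\<eta> :: nat \<Rightarrow> real).
      L > 0 \<longrightarrow> Ls > 0 \<longrightarrow> \<delta> > 0 \<longrightarrow> \<mu> > 0 \<longrightarrow>
      is_gradient_on (Rn d) f grad \<longrightarrow>
      glocally_smooth (Rn d) f grad L Ls \<delta> \<longrightarrow>
      locally_strongly_convex (Rn d) f grad \<mu> \<delta> \<longrightarrow>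
      convex_on (Rn d) f \<longrightarrow>
      coercive_on (Rn d) f \<longrightarrow>
      w0 \<in> Rn d \<longrightarrow>
      f w0 - infimum_on (Rn d) f > \<delta> \<longrightarrow> \<delta> > \<epsilon> \<longrightarrow> \<epsilon> > 0 \<longrightarrow>
      w 0 = w0 \<longrightarrow>
      gd_exact_line_search f grad w \<eta> \<longrightarrow>
      (\<forall>T::nat. real T \<ge> C * (L / \<delta> * R2 (Rn d) f (f w0) + Ls / \<mu> * ln (\<delta> / \<epsilon>)) \<longrightarrow>
        f (w T) - infimum_on (Rn d) f \<le> \<epsilon>))"
proof (intro exI[of _ "5::real"] conjI allI impI)
  fix d :: nat and f :: "fseq \<Rightarrow> real" and grad :: "fseq \<Rightarrow> fseq"
    and L Ls \<delta> \<mu> \<epsilon> :: real and w0 :: fseq and w :: "nat \<Rightarrow> fseq" and \<eta> :: "nat \<Rightarrow> real" and T :: nat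
  assume pos: "L > 0" "Ls > 0" "\<delta> > 0" "\<mu> > 0" and "\<epsilon> > 0"
    and grad: "is_gradient_on (Rn d) f grad"
    and smooth: "glocally_smooth (Rn d) f grad L Ls \<delta>"
    and strong: "locally_strongly_convex (Rn d) f grad \<mu> \<delta>"
    and conv: "convex_on (Rn d) f" and coer: "coercive_on (Rn d) f"
    and w0: "w0 \<in> Rn d" "f w0 - infimum_on (Rn d) f > \<delta>" "w 0 = w0"
    and "\<delta> > \<epsilon>" and gd: "gd_exact_line_search f grad w \<eta>"
    and T: "real T \<ge> 5 * (L / \<delta> * R2 (Rn d) f (f w0) + Ls / \<mu> * ln (\<delta> / \<epsilon>))"
  have "continuous_on (Rn d) f"
    using grad by (rule is_gradient_on_imp_continuous_on)
  then have "compact {x \<in> Rn d. f x \<le> \<rho>}" for \<rho>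
    using coer by (rule compact_sublevel_Rn)
  then show "f (w T) - infimum_on (Rn d) f \<le> \<epsilon>"
    using gd_exact_line_search_complexity[OF subspace_Rn _ pos \<open>\<epsilon> > 0\<close> grad smooth strong conv]
      w0 gd T \<open>\<delta> > \<epsilon>\<close> by blast
qed simp

end
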